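(* Let $(\mathcal{X},d_{\mathcal{X}})$ be a compact metric space with diameter $T_{\mathcal{X}}$, $(\mathcal{Y},d_{\mathcal{Y}})$ a metric space, $f\colon\mathcal{X}\to\mathcal{Y}$ continuous, and $[a,b]\subset[0,T_{\mathcal{X}}]$. Let $\{X_{N_k}\}_{k\in\mathbb{N}}$ be a sequence of finite subsets of $\mathcal{X}$ such that $X_{N_k}$ is an $r_k/2$-net for $\mathcal{X}$, with $r_k\to0$ as $k\to\infty$. Then, for all $p\in[1,\infty)$, $$\|\omega(f,\cdot)-\omega_{N_k}(f,\cdot)\|_{L^p(a,b)}\to0\quad\text{as }k\to\infty.$$ If, in addition, $f$ has a continuous modulus of continuity, then also $$\|\omega(f,\cdot)-\omega_{N_k}(f,\cdot)\|_{L^\infty(a,b)}\to0\quad\text{as }k\to\infty.$$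
   Context: An $\varepsilon$-net for $\mathcal{X}$ is a subset $\mathcal{K}\subset\mathcal{X}$ such that each $x\in\mathcal{X}$ satisfies $d_{\mathcal{X}}(x,x')\leq\varepsilon$ for some $x'\in\mathcal{K}$. The modulus of continuity is $\omega(f,t)=\sup\{d_{\mathcal{Y}}(f(x),f(x')): x,x'\in\mathcal{X},\ d_{\mathcal{X}}(x,x')\leq t\}$ for $t\in[0,\infty]$; it is called continuous if $t\mapsto\omega(f,t)$ is continuous on $[0,\infty]$ (canonical topology). The discrete modulus of continuity with respect to a finite set $X_N\subset\mathcal{X}$ is $\omega_N(f,t)=\max\{d_{\mathcal{Y}}(f(x),f(x')): x,x'\in X_N,\ d_{\mathcal{X}}(x,x')\leq t\}$; $\omega_{N_k}$ is taken with respect to $X_{N_k}$. $L^p(a,b)$ is with respect to Lebesgue measure in $t$. *)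

theory Defs
  imports "HOL-Analysis.Analysis" "HOL-Probability.Essential_Supremum"
begin

definition eps_net :: "real \<Rightarrow> 'a::metric_space set \<Rightarrow> 'a set \<Rightarrow> bool" where
  "eps_net \<epsilon> X K \<longleftrightarrow> K \<subseteq> X \<and> (\<forall>x\<in>X. \<exists>x'\<in>K. dist x x' \<le> \<epsilon>)"

definition dist_values ::
    "'a::metric_space set \<Rightarrow> ('a \<Rightarrow> 'b::metric_space) \<Rightarrow> ennreal \<Rightarrow> ennreal set" where
  "dist_values X f t =
     {ennreal (dist (f x) (f x')) | x x'. x \<in> X \<and> x' \<in> X \<and> ennreal (dist x x') \<le> t}"

text \<open>Argument and value range over \<open>[0,\<infinity>]\<close>, rendered as \<^typ>\<open>ennreal\<close>.\<close>

definition modulus ::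
    "'a::metric_space set \<Rightarrow> ('a \<Rightarrow> 'b::metric_space) \<Rightarrow> ennreal \<Rightarrow> ennreal" where
  "modulus X f t = Sup (dist_values X f t)"

definition continuous_modulus ::
    "'a::metric_space set \<Rightarrow> ('a \<Rightarrow> 'b::metric_space) \<Rightarrow> bool" where
  "continuous_modulus X f \<longleftrightarrow> continuous_on UNIV (modulus X f)"

text \<open>Only meaningful for finite nonempty \<open>XN\<close>.\<close>

definition discrete_modulus ::
    "'a::metric_space set \<Rightarrow> ('a \<Rightarrow> 'b::metric_space) \<Rightarrow> ennreal \<Rightarrow> ennreal" where
  "discrete_modulus XN f t = Max (dist_values XN f t)"

text \<open>In the error function, both moduli are converted to reals so that their difference is the
  ordinary one. The conversion \<^const>\<open>enn2real\<close> sends \<open>\<infinity>\<close> to 0, but for continuous \<open>f\<close> on compact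
  \<open>X\<close> the value \<open>\<infinity>\<close> does not occur:\<close>

lemma modulus_finite:
  fixes X :: "'a::metric_space set" and f :: "'a \<Rightarrow> 'b::metric_space"
  assumes "compact X" "continuous_on X f"
  shows "modulus X f t < \<infinity>"
proof -
  have "bounded (f ` X)"
    using assms by (simp add: compact_continuous_image compact_imp_bounded)
  then have le: "dist (f x) (f x') \<le> diameter (f ` X)" if "x \<in> X" "x' \<in> X" for x x'
    using that by (auto intro: diameter_bounded_bound)
  have "modulus X f t \<le> ennreal (diameter (f ` X))"
    unfolding modulus_def dist_values_def by (rule Sup_least) (auto intro!: ennreal_leI le)
  then show ?thesis
    using order_le_less_trans by fastforce
qed

definition modulus_error ::
    "'a::metric_space set \<Rightarrow> 'a set \<Rightarrow> ('a \<Rightarrow> 'b::metric_space) \<Rightarrow> real \<Rightarrow> real" where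
  "modulus_error X XN f t =
     enn2real (modulus X f (ennreal t)) - enn2real (discrete_modulus XN f (ennreal t))"

text \<open>The norms take values in \<open>[0,\<infinity>]\<close> and are \<open>\<infinity>\<close> on functions outside the respective space,
  nonmeasurable ones included.\<close>

definition Lp_norm :: "real \<Rightarrow> 'a measure \<Rightarrow> ('a \<Rightarrow> real) \<Rightarrow> ennreal" where
  "Lp_norm p M g =
     (let I = (\<integral>\<^sup>+x. ennreal (\<bar>g x\<bar> powr p) \<partial>M) in
      if g \<in> borel_measurable M \<and> I < \<infinity> then ennreal (enn2real I powr (1 / p)) else \<infinity>)"

definition Linf_norm :: "'a measure \<Rightarrow> ('a \<Rightarrow> real) \<Rightarrow> ennreal" where
  "Linf_norm M g =
     (if g \<in> borel_measurable M then esssup M (\<lambda>x. ennreal \<bar>g x\<bar>) else \<infinity>)"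

end

theory Submission imports Defs begin

text \<open>With \<open>\<omega>\<close> extended by \<open>\<omega>(t) = \<omega>(0) = 0\<close> to \<open>t < 0\<close>, moving two points of \<open>X\<close> to nearest net
  points gives \<open>0 \<le> \<omega>(t) - \<omega>\<^sub>N(t) \<le> \<omega>(t) - \<omega>(t - r) + 2 \<omega>(r/2)\<close>. Here \<open>\<omega>(r/2) \<rightarrow> 0\<close> because \<open>f\<close> is
  uniformly continuous. The monotone function \<open>\<omega>\<close> has only countably many discontinuities, so the
  error tends to \<open>0\<close> almost everywhere and dominated convergence applies; if \<open>\<omega>\<close> is continuous, it
  is uniformly continuous on compact intervals and the convergence is uniform.\<close>

section \<open>Criteria for norms to tend to zero\<close>

text \<open>Dominated convergence: the constant \<open>C powr p\<close> is an integrable majorant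
  because \<open>M\<close> is finite.\<close>

lemma Lp_norm_tendsto_0:
  assumes fin: "finite_measure M"
    and meas: "\<And>k. g k \<in> borel_measurable M"
    and bound: "\<And>k x. x \<in> space M \<Longrightarrow> \<bar>g k x\<bar> \<le> C"
    and lim: "AE x in M. (\<lambda>k. g k x) \<longlonglongrightarrow> 0"
    and p: "p > 0"
  shows "(\<lambda>k. Lp_norm p M (g k)) \<longlonglongrightarrow> 0"
proof -
  define I where "I k = (\<integral>\<^sup>+x. ennreal (\<bar>g k x\<bar> powr p) \<partial>M)" for k
  have le: "ennreal (\<bar>g k x\<bar> powr p) \<le> ennreal (C powr p)" if "x \<in> space M" for k x
    using bound[OF that] p by (intro ennreal_leI powr_mono2) auto
  have const: "(\<integral>\<^sup>+x. ennreal (C powr p) \<partial>M) < \<infinity>"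
    using finite_measure.emeasure_finite[OF fin, of "space M"]
    by (simp add: ennreal_mult_less_top less_top)
  have I_fin: "I k < \<infinity>" for k
    unfolding I_def by (rule le_less_trans[OF nn_integral_mono const]) (rule le)
  have "I \<longlonglongrightarrow> (\<integral>\<^sup>+x. 0 \<partial>M)"
    unfolding I_def
  proof (rule nn_integral_dominated_convergence[where w = "\<lambda>_. ennreal (C powr p)"])
    show "(\<lambda>x. ennreal (\<bar>g k x\<bar> powr p)) \<in> borel_measurable M" for k
      using meas[of k] by measurable
    show "AE x in M. ennreal (\<bar>g k x\<bar> powr p) \<le> ennreal (C powr p)" for k
      using le by auto
    show "AE x in M. (\<lambda>k. ennreal (\<bar>g k x\<bar> powr p)) \<longlonglongrightarrow> 0"
      using lim
    proof eventually_elim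
      case (elim x)
      have "(\<lambda>k. \<bar>g k x\<bar> powr p) \<longlonglongrightarrow> 0"
        by (rule tendsto_zero_powrI[where b = p])
          (use elim p in \<open>auto intro: tendsto_rabs_zero\<close>)
      then show ?case
        using tendsto_ennrealI by fastforce
    qed
  qed (use const in auto)
  then have "(\<lambda>k. enn2real (I k)) \<longlonglongrightarrow> enn2real 0"
    by (intro tendsto_enn2real) auto
  then have "(\<lambda>k. enn2real (I k) powr (1 / p)) \<longlonglongrightarrow> 0"
    by (intro tendsto_zero_powrI[where b = "1 / p"]) (use p in auto)
  then have "(\<lambda>k. ennreal (enn2real (I k) powr (1 / p))) \<longlonglongrightarrow> 0"
    using tendsto_ennrealI by fastforce
  then show ?thesis
    using meas I_fin unfolding Lp_norm_def I_def by (simp add: Let_def)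
qed

lemma Linf_norm_tendsto_0:
  assumes meas: "\<And>k. g k \<in> borel_measurable M"
    and lim: "uniform_limit (space M) g (\<lambda>_. 0) sequentially"
  shows "(\<lambda>k. Linf_norm M (g k)) \<longlonglongrightarrow> 0"
proof (rule order_tendstoI)
  fix c :: ennreal
  assume "0 < c"
  \<comment> \<open>A real \<open>e\<close> strictly below \<open>c\<close> serves even for infinite
    \<open>c\<close>, and it absorbs the non-strict bound on the essential supremum.\<close>
  then obtain e where e: "0 < e" "ennreal e < c"
    using dense[of 0 c] by (metis ennreal_cases ennreal_less_zero_iff infinity_ennreal_def not_top_less)
  from uniform_limitD[OF lim e(1)] show "\<forall>\<^sub>F k in sequentially. Linf_norm M (g k) < c"
  proof eventually_elim
    case (elim k)
    have "esssup M (\<lambda>x. ennreal \<bar>g k x\<bar>) \<le> ennreal e"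
      using elim meas[of k] by (intro esssup_I AE_I2 ennreal_leI) (auto intro: less_imp_le)
    then show ?case
      using meas[of k] e(2) by (simp add: Linf_norm_def)
  qed
qed auto

section \<open>The modulus of continuity as a real function\<close>

lemma dist_le_modulus:
  assumes "compact X" "continuous_on X f" "x \<in> X" "x' \<in> X" "dist x x' \<le> t"
  shows "dist (f x) (f x') \<le> enn2real (modulus X f (ennreal t))"
proof -
  have "ennreal (dist (f x) (f x')) \<le> modulus X f (ennreal t)"
    unfolding modulus_def dist_values_def
    using assms(3-5) by (intro Sup_upper) (auto intro!: ennreal_leI)
  from enn2real_mono[OF this] show ?thesis
    using modulus_finite[OF assms(1,2)] by (simp add: less_top)
qed

lemma modulus_le:
  assumes "\<And>x x'. x \<in> X \<Longrightarrow> x' \<in> X \<Longrightarrow> ennreal (dist x x') \<le> t \<Longrightarrow> dist (f x) (f x') \<le> c"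
    and "0 \<le> c"
  shows "enn2real (modulus X f t) \<le> c"
proof -
  have "modulus X f t \<le> ennreal c"
    unfolding modulus_def dist_values_def
    using assms(1) by (intro Sup_least) (auto intro!: ennreal_leI)
  from enn2real_mono[OF this] show ?thesis
    using assms(2) by simp
qed

lemma modulus_0 [simp]: "enn2real (modulus X f 0) = 0"
proof -
  have "enn2real (modulus X f 0) \<le> 0"
    by (rule modulus_le) auto
  then show ?thesis
    by (simp add: antisym)
qed

text \<open>\<open>ennreal\<close> truncates negative reals to 0, so this is the extension of the
  modulus by 0 that gives \<open>t - r\<close> a meaning for \<open>t < r\<close>.\<close>

lemma modulus_neg: "t \<le> 0 \<Longrightarrow> enn2real (modulus X f (ennreal t)) = 0"
  by (simp add: ennreal_neg)

text \<open>Monotonicity yields both Borel measurability and the countability of the set of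
  discontinuities.\<close>

lemma mono_modulus:
  assumes "compact X" "continuous_on X f"
  shows "mono (\<lambda>t. enn2real (modulus X f (ennreal t)))"
proof (rule monoI)
  fix s t :: real
  assume "s \<le> t"
  then have "modulus X f (ennreal s) \<le> modulus X f (ennreal t)"
    unfolding modulus_def dist_values_def
    by (intro Sup_subset_mono) (auto dest: order_trans[OF _ ennreal_leI])
  then show "enn2real (modulus X f (ennreal s)) \<le> enn2real (modulus X f (ennreal t))"
    using modulus_finite[OF assms] by (intro enn2real_mono) (auto simp: less_top)
qed

lemma modulus_tendsto_0:
  assumes "compact X" "continuous_on X f" "r \<longlonglongrightarrow> 0"
  shows "(\<lambda>k. enn2real (modulus X f (ennreal (r k)))) \<longlonglongrightarrow> 0"
proof (rule LIMSEQ_I)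
  fix e :: real
  assume "0 < e"
  have "uniformly_continuous_on X f"
    using assms by (simp add: compact_uniformly_continuous)
  \<comment> \<open>The supremum turns strict bounds into non-strict ones; \<open>e / 2\<close>
    leaves room for the strict \<open>< e\<close>.\<close>
  then obtain d where d: "d > 0"
    "\<And>x x'. x \<in> X \<Longrightarrow> x' \<in> X \<Longrightarrow> dist x x' < d \<Longrightarrow> dist (f x) (f x') < e / 2"
    unfolding uniformly_continuous_on_def using \<open>0 < e\<close> by (metis half_gt_zero)
  from LIMSEQ_D[OF assms(3) \<open>d > 0\<close>] obtain N where N: "\<And>k. k \<ge> N \<Longrightarrow> \<bar>r k\<bar> < d"
    by auto
  have "norm (enn2real (modulus X f (ennreal (r k))) - 0) < e" if "k \<ge> N" for k
  proof -
    have "enn2real (modulus X f (ennreal (r k))) \<le> e / 2"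
    proof (rule modulus_le)
      fix x x'
      assume *: "x \<in> X" "x' \<in> X" "ennreal (dist x x') \<le> ennreal (r k)"
      \<comment> \<open>For negative \<open>r k\<close> the radius is truncated to 0, so the
        distance is 0.\<close>
      from *(3) have "dist x x' < d"
        using N[OF that] \<open>d > 0\<close>
        by (cases "r k \<ge> 0") (auto simp: ennreal_le_iff ennreal_neg)
      with d(2) * show "dist (f x) (f x') \<le> e / 2"
        by (meson less_imp_le)
    qed (use \<open>0 < e\<close> in simp)
    then show ?thesis
      using \<open>0 < e\<close> by simp
  qed
  then show "\<exists>N. \<forall>k\<ge>N. norm (enn2real (modulus X f (ennreal (r k))) - 0) < e"
    by blast
qed

section \<open>Comparison of the moduli on the space and on a net\<close>

text \<open>Writing the maximum as a supremum makes the facts about \<open>modulus\<close> available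
  on the net. The pair \<open>(x, x)\<close> keeps the set of values nonempty for every
  \<open>t\<close>.\<close>

lemma discrete_modulus_eq_modulus:
  assumes "finite XN" "XN \<noteq> {}"
  shows "discrete_modulus XN f t = modulus XN f t"
proof -
  have "dist_values XN f t \<subseteq> (\<lambda>(x, x'). ennreal (dist (f x) (f x'))) ` (XN \<times> XN)"
    unfolding dist_values_def by auto
  then have "finite (dist_values XN f t)"
    using assms(1) by (meson finite_SigmaI finite_imageI finite_subset)
  moreover obtain x where "x \<in> XN"
    using assms(2) by blast
  then have "ennreal (dist (f x) (f x)) \<in> dist_values XN f t"
    unfolding dist_values_def by fastforce
  ultimately show ?thesis
    unfolding discrete_modulus_def modulus_def by (intro Max_Sup) auto
qed

context
  fixes X XN :: "'a::metric_space set" and f :: "'a \<Rightarrow> 'b::metric_space" and r :: real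
  assumes X: "compact X" "continuous_on X f" "X \<noteq> {}"
    and XN: "finite XN" "eps_net (r / 2) X XN"
begin

text \<open>A point of \<open>X\<close> has a net point within \<open>r / 2\<close>; this point
  witnesses nonemptiness, and its distance forces the sign of \<open>r\<close>.\<close>

lemma net_subset: "XN \<subseteq> X"
  and net_nonempty: "XN \<noteq> {}"
  and net_radius_nonneg: "0 \<le> r"
proof -
  show "XN \<subseteq> X"
    using XN unfolding eps_net_def by blast
  obtain x x' where "x' \<in> XN" "dist x x' \<le> r / 2"
    using X(3) XN(2) unfolding eps_net_def by blast
  then show "XN \<noteq> {}" "0 \<le> r"
    using zero_le_dist[of x x'] by (auto simp del: zero_le_dist)
qed

lemma modulus_error_eq:
  "modulus_error X XN f =
     (\<lambda>t. enn2real (modulus X f (ennreal t)) - enn2real (modulus XN f (ennreal t)))"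
  unfolding modulus_error_def using discrete_modulus_eq_modulus XN(1) net_nonempty by metis

lemma continuous_on_net: "compact XN" "continuous_on XN f"
  using XN(1) finite_imp_compact continuous_on_finite by auto

lemma modulus_error_borel: "modulus_error X XN f \<in> borel_measurable borel"
  unfolding modulus_error_eq
  by (intro borel_measurable_diff borel_measurable_mono mono_modulus X continuous_on_net)

lemma modulus_error_nonneg: "0 \<le> modulus_error X XN f t"
proof -
  have "modulus XN f (ennreal t) \<le> modulus X f (ennreal t)"
    unfolding modulus_def dist_values_def using net_subset
    by (intro Sup_subset_mono) auto
  then show ?thesis
    unfolding modulus_error_eq using modulus_finite[OF X(1,2)]
    by (simp add: enn2real_mono less_top)
qed

text \<open>Moving both points of a pair to net points lengthens their distance by at most
  \<open>r\<close>, hence the shift \<open>t - r\<close>, and costs at most \<open>w (r / 2)\<close>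
  per endpoint in the image, hence the factor 2.\<close>

lemma modulus_error_le:
  defines "w \<equiv> \<lambda>t. enn2real (modulus X f (ennreal t))"
  shows "modulus_error X XN f t \<le> w t - w (t - r) + 2 * w (r / 2)"
proof -
  define wN where "wN = enn2real (modulus XN f (ennreal t))"
  have "w (t - r) \<le> wN + 2 * w (r / 2)"
  \<comment> \<open>For \<open>t < r\<close> the left side is 0. Otherwise \<open>t - r\<close>
    survives \<open>ennreal\<close> untruncated, and the bound on \<open>dist x x'\<close> is a real
    one.\<close>
  proof (cases "t \<ge> r")
    case True
    show ?thesis
    proof (subst w_def, rule modulus_le)
      fix x x'
      assume x: "x \<in> X" "x' \<in> X" and "ennreal (dist x x') \<le> ennreal (t - r)"
      then have d: "dist x x' \<le> t - r"
        using True by simp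
      from x XN(2) obtain y y' where y: "y \<in> XN" "dist x y \<le> r / 2" "y' \<in> XN" "dist x' y' \<le> r / 2"
        unfolding eps_net_def by blast
      have "dist y y' \<le> dist x y + dist x x' + dist x' y'"
        by metric
      with d y have "dist y y' \<le> t"
        by simp
      then have "dist (f y) (f y') \<le> wN"
        unfolding wN_def using y by (intro dist_le_modulus continuous_on_net)
      moreover have "dist (f x) (f y) \<le> w (r / 2)" "dist (f x') (f y') \<le> w (r / 2)"
        unfolding w_def using x y net_subset by (auto intro!: dist_le_modulus X)
      moreover have "dist (f x) (f x') \<le> dist (f x) (f y) + dist (f y) (f y') + dist (f x') (f y')"
        by metric
      ultimately show "dist (f x) (f x') \<le> wN + 2 * w (r / 2)"
        by linarith
    qed (simp add: wN_def w_def)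
  next
    case False
    then show ?thesis
      by (simp add: w_def wN_def modulus_neg)
  qed
  then show ?thesis
    unfolding modulus_error_eq by (simp add: w_def wN_def)
qed

end

section \<open>From the pointwise bound to convergence in norm\<close>

theorem corollary3p11:
  fixes X :: "'a::metric_space set" and f :: "'a \<Rightarrow> 'b::metric_space"
    and XN :: "nat \<Rightarrow> 'a set" and r :: "nat \<Rightarrow> real" and a b :: real
  assumes "compact X"
    and "continuous_on X f"
    and "0 \<le> a" and "a \<le> b" and "b \<le> diameter X"
    and "\<And>k. finite (XN k)"
    and "\<And>k. eps_net (r k / 2) X (XN k)"
    and "r \<longlonglongrightarrow> 0"
  shows "(\<forall>p::real. p \<ge> 1 \<longrightarrow>
            (\<lambda>k. Lp_norm p (lebesgue_on {a<..<b}) (modulus_error X (XN k) f)) \<longlonglongrightarrow> 0) \<and>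
         (continuous_modulus X f \<longrightarrow>
            (\<lambda>k. Linf_norm (lebesgue_on {a<..<b}) (modulus_error X (XN k) f)) \<longlonglongrightarrow> 0)"
proof -
  define M where "M = lebesgue_on {a<..<b}"
  define g where "g k = modulus_error X (XN k) f" for k
  define w where "w t = enn2real (modulus X f (ennreal t))" for t
  have space_M: "space M = {a<..<b}"
    by (simp add: M_def)
  have fin: "finite_measure M"
    by (rule finite_measureI)
      (use assms(4) in \<open>simp add: M_def emeasure_restrict_space emeasure_completion\<close>)
  \<comment> \<open>The empty set has diameter 0, which forces \<open>a = b = 0\<close>.\<close>
  have empty: "space M = {}" if "X = {}"
    using assms(3-5) that by (simp add: space_M)
  have meas: "g k \<in> borel_measurable M" for k
  \<comment> \<open>An empty \<open>X\<close> has only empty nets, and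
    \<open>discrete_modulus\<close> is then an unspecified \<open>Max {}\<close>; measurability
    comes from the empty domain instead.\<close>
  proof (cases "X = {}")
    case True
    then show ?thesis
      by (simp add: measurable_def empty)
  next
    case False
    then have "g k \<in> borel_measurable borel"
      unfolding g_def by (rule modulus_error_borel[OF assms(1,2) _ assms(6,7)])
    then show ?thesis
      unfolding M_def by (intro measurable_restrict_space1 measurable_completion) simp
  qed
  have nonneg: "0 \<le> g k t" and upper: "g k t \<le> w t - w (t - r k) + 2 * w (r k / 2)"
    if "t \<in> space M" for k t
  proof -
    have "X \<noteq> {}"
      using empty that by auto
    then show "0 \<le> g k t" "g k t \<le> w t - w (t - r k) + 2 * w (r k / 2)"
      unfolding g_def w_def
      using modulus_error_nonneg[OF assms(1,2) _ assms(6,7)]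
        modulus_error_le[OF assms(1,2) _ assms(6,7)] by auto
  qed
  have w0: "(\<lambda>k. w (r k / 2)) \<longlonglongrightarrow> 0"
    unfolding w_def using assms tendsto_divide_zero by (intro modulus_tendsto_0) auto
  have mono_w: "mono w"
    unfolding w_def using assms by (intro mono_modulus)
  have lim: "AE t in M. (\<lambda>k. g k t) \<longlonglongrightarrow> 0"
  proof -
    have "countable {t. \<not> isCont w t}"
      using mono_ctble_discont mono_w by blast
    then have "AE t in lebesgue. isCont w t"
      by (intro AE_I'[where N = "{t. \<not> isCont w t}"])
         (auto intro: countable_imp_null_set_lborel null_sets_completionI)
    then have "AE t in M. isCont w t"
      unfolding M_def by (auto simp: AE_restrict_space_iff elim: eventually_mono)
    then show ?thesis
    proof (rule AE_mp, intro AE_I2 impI)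
      fix t
      assume t: "t \<in> space M" and "isCont w t"
      moreover have "(\<lambda>k. t - r k) \<longlonglongrightarrow> t"
        using assms(8) by (auto intro!: tendsto_eq_intros)
      ultimately have "(\<lambda>k. w (t - r k)) \<longlonglongrightarrow> w t"
        using isCont_tendsto_compose by blast
      then have "(\<lambda>k. w t - w (t - r k) + 2 * w (r k / 2)) \<longlonglongrightarrow> 0"
        using w0 by (auto intro!: tendsto_eq_intros)
      then show "(\<lambda>k. g k t) \<longlonglongrightarrow> 0"
        by (rule tendsto_sandwich[OF _ _ tendsto_const, rotated 2]) (use nonneg upper t in auto)
    qed
  qed
  \<comment> \<open>The error is nonnegative and arises from \<open>w t\<close> by subtracting a
    nonnegative number, so one constant dominates for all \<open>k\<close>.\<close>
  have bound: "\<bar>g k t\<bar> \<le> w b" if "t \<in> space M" for k t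
  proof -
    have "\<bar>g k t\<bar> \<le> w t"
      using nonneg[OF that, of k] by (simp add: g_def modulus_error_def w_def)
    also have "\<dots> \<le> w b"
      using monoD[OF mono_w, of t b] that by (simp add: space_M)
    finally show ?thesis .
  qed
  have "(\<lambda>k. Linf_norm M (g k)) \<longlonglongrightarrow> 0" if "continuous_modulus X f"
  proof (rule Linf_norm_tendsto_0[OF meas], rule uniform_limitI)
    fix e :: real
    assume "0 < e"
    have "continuous_on UNIV w"
      unfolding continuous_on_def
    proof
      fix t :: real
      have "continuous_on UNIV (\<lambda>t. modulus X f (ennreal t))"
        using that continuous_on_ennreal[OF continuous_on_id]
        unfolding continuous_modulus_def by (rule continuous_on_compose2) simp
      moreover have "modulus X f (ennreal t) = ennreal (w t)"
        using modulus_finite[OF assms(1,2)] by (simp add: w_def)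
      ultimately have "((\<lambda>t. modulus X f (ennreal t)) \<longlongrightarrow> ennreal (w t)) (at t)"
        unfolding continuous_on_def by (metis UNIV_I)
      \<comment> \<open>The limit is finite, and \<open>enn2real\<close> is continuous at finite
        values.\<close>
      then have "((\<lambda>t. enn2real (modulus X f (ennreal t))) \<longlongrightarrow> w t) (at t)"
        by (rule tendsto_enn2real) (simp add: w_def)
      then show "(w \<longlongrightarrow> w t) (at t)"
        by (simp add: w_def[abs_def])
    qed
    \<comment> \<open>The margin 1 on the left holds every \<open>t - r k\<close> with
      \<open>a < t\<close> and \<open>r k < 1\<close>.\<close>
    then have "uniformly_continuous_on {a - 1..b} w"
      by (meson compact_Icc compact_uniformly_continuous continuous_on_subset top_greatest)
    then obtain d where d: "d > 0"
      "\<And>s t. s \<in> {a - 1..b} \<Longrightarrow> t \<in> {a - 1..b} \<Longrightarrow> dist s t < d \<Longrightarrow> dist (w s) (w t) < e / 2"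
      unfolding uniformly_continuous_on_def using \<open>0 < e\<close> by (metis half_gt_zero)
    \<comment> \<open>The bound 1 keeps \<open>t - r k\<close> in the enlarged interval,
      \<open>d\<close> makes the increment of \<open>w\<close> less than \<open>e / 2\<close>, and
      \<open>e / 4\<close> bounds a term that occurs twice.\<close>
    have "\<forall>\<^sub>F k in sequentially. \<bar>r k\<bar> < min 1 d" "\<forall>\<^sub>F k in sequentially. \<bar>w (r k / 2)\<bar> < e / 4"
      using tendstoD[OF assms(8), of "min 1 d"] tendstoD[OF w0, of "e / 4"] \<open>0 < e\<close> d(1)
      by (auto simp: dist_real_def)
    then show "\<forall>\<^sub>F k in sequentially. \<forall>t\<in>space M. dist (g k t) 0 < e"
    proof eventually_elim
      case (elim k)
      show ?case
      proof
        fix t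
        assume t: "t \<in> space M"
        then have "X \<noteq> {}"
          using empty by auto
        \<comment> \<open>The sign gives \<open>t - r k \<le> b\<close>, the right end of the
          interval of uniform continuity.\<close>
        then have "0 \<le> r k"
          by (rule net_radius_nonneg[OF assms(1,2) _ assms(6,7)])
        then have "dist (w t) (w (t - r k)) < e / 2"
          using t elim by (intro d(2)) (auto simp: space_M dist_real_def)
        then show "dist (g k t) 0 < e"
          using nonneg[OF t, of k] upper[OF t, of k] elim unfolding dist_real_def by linarith
      qed
    qed
  qed
  moreover have "(\<lambda>k. Lp_norm p M (g k)) \<longlonglongrightarrow> 0" if "p \<ge> 1" for p
    using that by (intro Lp_norm_tendsto_0[OF fin meas bound lim]) auto
  ultimately show ?thesis
    unfolding M_def g_def by blast
qed

end
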